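(* Let $N\ge0$ be an integer and $\alpha,\beta$ real with $\beta+2-\alpha\notin\{1,\dots,N\}$. For $m,n\in\{0,\dots,N\}$ and constants $\gamma_n,\delta_m^*$, set $$\tilde U_m(n)=\frac{1}{2\pi i}\oint_\Gamma \gamma_n\delta^*_m\,x^{-1+n-N}(1-x)^{1-\alpha}\,{}_2F_1\!\left({m-N,\,-m-\beta\atop -N};x\right)dx .$$ Then $$\tilde U_m(n)=\delta^*_m\gamma_n\,\frac{(\alpha-\beta-1)_{N-n}}{(N-n)!}\;{}_3F_2\!\left({n-N,\,-m,\,m-N+\beta\atop -N,\;\beta+2-\alpha-N+n};1\right).$$
   Context: $(a)_k=a(a+1)\cdots(a+k-1)$. $\Gamma$ is the positively oriented circle $|x|=a$ with $0<a<1$, and $(1-x)^{s}$ is the branch equal to $1$ at $x=0$. Terminating hypergeometric series with lower parameter $-N$ are understood as the finite sums ending at the first vanishing numerator Pochhammer symbol: ${}_2F_1(m-N,b;-N;x)=\sum_{k=0}^{N-m}\frac{(m-N)_k(b)_k}{(-N)_kk!}x^k$, and ${}_3F_2(n-N,-m,b;-N,c;1)=\sum_{k=0}^{\min(m,N-n)}\frac{(n-N)_k(-m)_k(b)_k}{(-N)_k(c)_kk!}$. (Up to sign, $\tilde U_m(n)$ is the overlap $(e^*_m,Zd_n)$ in the differential realization of the meta-Hahn algebra and is the biorthogonal partner of the rational function of Hahn type.) *)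

theory Defs
  imports "HOL-Complex_Analysis.Complex_Analysis"
begin

text \<open>
  The terminating series \<open>\<^sub>2F\<^sub>1(m - N, b; -N; x)\<close> for \<open>m \<le> N\<close>.  Both this series and the next one are
  finite sums cut off so that \<open>(-N)\<^sub>k\<close> never vanishes; the truncated subtractions \<open>N - m\<close> and
  \<open>N - n\<close> are exact for \<open>m, n \<le> N\<close>.
\<close>

definition hahn_2F1 :: "nat \<Rightarrow> nat \<Rightarrow> complex \<Rightarrow> complex \<Rightarrow> complex" where
  "hahn_2F1 N m b x =
     (\<Sum>k=0..N - m. pochhammer (of_nat m - of_nat N) k * pochhammer b k /
        (pochhammer (- of_nat N) k * fact k) * x ^ k)"

text \<open>The terminating series \<open>\<^sub>3F\<^sub>2(n - N, -m, b; -N, c; 1)\<close> for \<open>m, n \<le> N\<close>.\<close>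

definition hahn_3F2 :: "nat \<Rightarrow> nat \<Rightarrow> nat \<Rightarrow> complex \<Rightarrow> complex \<Rightarrow> complex" where
  "hahn_3F2 N n m b c =
     (\<Sum>k=0..min m (N - n).
        pochhammer (of_nat n - of_nat N) k * pochhammer (- of_nat m) k * pochhammer b k /
        (pochhammer (- of_nat N) k * pochhammer c k * fact k))"

text \<open>
  The contour is the circle of radius \<open>a\<close> about \<open>0\<close>.  For \<open>0 < a < 1\<close> the principal power
  \<open>(1 - x) powr s\<close> is holomorphic on \<open>|x| < 1\<close> with value \<open>1\<close> at \<open>x = 0\<close>, so it is the required branch.
\<close>

definition U_tilde ::
  "real \<Rightarrow> nat \<Rightarrow> real \<Rightarrow> real \<Rightarrow> (nat \<Rightarrow> complex) \<Rightarrow> (nat \<Rightarrow> complex) \<Rightarrow> nat \<Rightarrow> nat \<Rightarrow> complex" where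
  "U_tilde a N \<alpha> \<beta> \<gamma> \<delta> m n =
     1 / (2 * of_real pi * \<i>) *
     contour_integral (circlepath 0 a)
       (\<lambda>x. \<gamma> n * \<delta> m * x powi (- 1 + int n - int N) * (1 - x) powr of_real (1 - \<alpha>) *
            hahn_2F1 N m (of_real (- real m - \<beta>)) x)"

end

theory Submission
  imports Defs
begin

text \<open>
  By Cauchy's formula, the integral is the coefficient of \<open>x\<^sup>N\<^sup>-\<^sup>n\<close> in
  \<open>(1 - x)\<^bsup>1 - \<alpha>\<^esup> \<^sub>2F\<^sub>1(m - N, -m - \<beta>; -N; x)\<close>.  Euler's transformation turns this product into
  \<open>(1 - x)\<^bsup>1 + \<beta> - \<alpha>\<^esup> \<^sub>2F\<^sub>1(-m, m - N + \<beta>; -N; x)\<close>, whose coefficient is the asserted \<open>\<^sub>3F\<^sub>2\<close>.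
  For the lower parameter \<open>-N\<close> Euler's transformation holds only up to order \<open>N\<close>, because its \<open>K\<close>-th
  coefficient is the Pfaff--Saalschuetz sum divided by \<open>(-N)\<^sub>K\<close>; this suffices since \<open>N - n \<le> N\<close>.
\<close>

section \<open>The Pfaff--Saalschuetz sum\<close>

lemma pochhammer_shift_diff:
  fixes s :: "'a::comm_ring_1"
  shows "pochhammer (s + 1) (Suc i) - pochhammer s (Suc i) = of_nat (Suc i) * pochhammer (s + 1) i"
proof -
  have "pochhammer (s + 1) (Suc i) = (s + 1 + of_nat i) * pochhammer (s + 1) i"
    by (rule pochhammer_rec')
  moreover have "pochhammer s (Suc i) = s * pochhammer (s + 1) i"
    by (rule pochhammer_rec)
  ultimately show ?thesis
    by (simp add: algebra_simps)
qed

text \<open>This is the cancellation behind \<open>merge\<close> below. The symbols with bases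
  \<open>s + 1\<close> and \<open>s\<close> share all but one factor, and the factor
  \<open>K - j\<close> left over is absorbed into the binomial coefficient.\<close>

lemma binomial_pochhammer_shift_diff:
  fixes s :: "'a::comm_ring_1"
  assumes "j \<le> K"
  shows "of_nat (K choose j) * (pochhammer (s + 1) (K - j) - pochhammer s (K - j)) =
    of_nat (Suc j) * of_nat (K choose Suc j) * pochhammer (s + 1) (K - Suc j)"
proof (cases "j = K")
  case False
  with assms have "K - j = Suc (K - Suc j)" by simp
  then have d: "pochhammer (s + 1) (K - j) - pochhammer s (K - j) =
      of_nat (K - j) * pochhammer (s + 1) (K - Suc j)"
    using pochhammer_shift_diff[of s "K - Suc j"] by simp
  have "(K choose j) * (K - j) = Suc j * (K choose Suc j)"
    using binomial_absorb_comp[of K j] binomial_absorption[of j K]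
    by (simp add: mult.commute)
  then have "of_nat (K choose j) * of_nat (K - j) = (of_nat (Suc j) * of_nat (K choose Suc j) :: 'a)"
    by (metis of_nat_mult)
  with d show ?thesis
    by (simp add: mult.assoc[symmetric])
qed (simp add: binomial_eq_0)

text \<open>
  With denominators cleared, the Pfaff--Saalschuetz sum needs no hypothesis on \<open>c\<close>.  Splitting the
  factor \<open>(c - u) (c - v)\<close> differently in each summand reduces the case \<open>Suc K\<close> at \<open>c\<close> to the case \<open>K\<close>
  at \<open>c + 1\<close>.
\<close>

lemma pochhammer_saalschuetz:
  fixes c u v :: "'a::comm_ring_1"
  shows "pochhammer (c - u) K * pochhammer (c - v) K =
    (\<Sum>k\<le>K. of_nat (K choose k) * pochhammer u k * pochhammer v k *
       pochhammer (c - u - v) (K - k) * pochhammer (c + of_nat k) (K - k))"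
proof (induction K arbitrary: c)
  case 0
  then show ?case by simp
next
  case (Suc K)
  define s where "s = c - u - v"
  define A where "A k = of_nat (K choose k) * pochhammer u k * pochhammer v k *
      pochhammer s (Suc K - k) * pochhammer (c + of_nat k) (Suc K - k)" for k
  define B where "B k = of_nat (K choose k) * pochhammer u (Suc k) * pochhammer v (Suc k) *
      pochhammer (s + 1) (K - k) * pochhammer (c + of_nat (Suc k)) (K - k)" for k
  define D where "D k = of_nat k * of_nat (K choose k) * pochhammer u k * pochhammer v k *
      pochhammer (s + 1) (K - k) * pochhammer (c + of_nat k) (Suc K - k)" for k
  define T where "T k = of_nat (Suc K choose k) * pochhammer u k * pochhammer v k *
      pochhammer s (Suc K - k) * pochhammer (c + of_nat k) (Suc K - k)" for k
  have split: "(c - u) * (c - v) * (of_nat (K choose k) * pochhammer u k * pochhammer v k *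
       pochhammer (c + 1 - u - v) (K - k) * pochhammer (c + 1 + of_nat k) (K - k)) = A k + B k - D k"
    if "k \<le> K" for k
  proof -
    \<comment> \<open>The first term extends the symbols in \<open>s + 1\<close> and
      \<open>c + 1 + k\<close> downwards, giving \<open>A k\<close>. The second raises the symbols
      in \<open>u\<close> and \<open>v\<close>, giving \<open>B k\<close>, which belongs to index
      \<open>k + 1\<close>. The third extends only the symbol in \<open>c + 1 + k\<close>, giving
      \<open>D k\<close>.\<close>
    have weight: "(c - u) * (c - v) = (c + of_nat k) * s + (u + of_nat k) * (v + of_nat k)
        - of_nat k * (c + of_nat k)"
      by (simp add: s_def algebra_simps)
    have S: "Suc K - k = Suc (K - k)" using that by simp
    have 1: "pochhammer s (Suc K - k) = s * pochhammer (s + 1) (K - k)"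
      unfolding S by (rule pochhammer_rec)
    have 2: "pochhammer (c + of_nat k) (Suc K - k) =
        (c + of_nat k) * pochhammer (c + 1 + of_nat k) (K - k)"
      unfolding S by (simp add: pochhammer_rec add_ac)
    have 3: "c + 1 - u - v = s + 1" "c + of_nat (Suc k) = c + 1 + of_nat k"
      by (simp_all add: s_def)
    show ?thesis
      unfolding A_def B_def D_def 1 2 3 pochhammer_rec' weight by (simp only: algebra_simps)
  qed
  have merge: "A (Suc j) + B j - D (Suc j) = T (Suc j)" if "j \<le> K" for j
  proof -
    define P where "P = pochhammer u (Suc j) * pochhammer v (Suc j) *
        pochhammer (c + of_nat (Suc j)) (K - j)"
    have "A (Suc j) + B j - D (Suc j) - T (Suc j) = P *
      (of_nat (K choose j) * (pochhammer (s + 1) (K - j) - pochhammer s (K - j)) -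
       of_nat (Suc j) * of_nat (K choose Suc j) * pochhammer (s + 1) (K - Suc j))"
      unfolding A_def B_def D_def T_def P_def diff_Suc_Suc binomial_Suc_Suc of_nat_add
      by (simp only: algebra_simps)
    then show ?thesis
      using binomial_pochhammer_shift_diff[OF that, of s] by simp
  qed
  have "pochhammer (c - u) (Suc K) * pochhammer (c - v) (Suc K) =
      (c - u) * (c - v) * (pochhammer (c + 1 - u) K * pochhammer (c + 1 - v) K)"
    by (simp add: pochhammer_rec algebra_simps)
  also have "\<dots> = (\<Sum>k\<le>K. A k + B k - D k)"
    unfolding Suc.IH sum_distrib_left by (intro sum.cong refl split) simp
  \<comment> \<open>Since \<open>K choose Suc K\<close> is 0, \<open>A\<close> and \<open>D\<close>
    may run one index further; then \<open>B j\<close> can meet \<open>A (Suc j)\<close> and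
    \<open>D (Suc j)\<close>.\<close>
  also have "\<dots> = (\<Sum>k\<le>Suc K. A k) + (\<Sum>k\<le>K. B k) - (\<Sum>k\<le>Suc K. D k)"
    by (simp add: sum.distrib sum_subtractf A_def D_def binomial_eq_0)
  also have "\<dots> = A 0 - D 0 + (\<Sum>j\<le>K. A (Suc j) + B j - D (Suc j))"
    by (simp add: sum.atMost_Suc_shift sum.distrib sum_subtractf del: sum.atMost_Suc)
  also have "\<dots> = T 0 + (\<Sum>j\<le>K. T (Suc j))"
    by (intro arg_cong2[of _ _ _ _ "(+)"] sum.cong merge) (auto simp: A_def D_def T_def)
  also have "\<dots> = (\<Sum>k\<le>Suc K. T k)"
    by (simp only: sum.atMost_Suc_shift)
  finally show ?case
    by (simp only: T_def s_def)
qed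

section \<open>Euler's transformation, coefficient by coefficient\<close>

text \<open>Here \<open>fps_hypergeo [s] [] 1\<close> is the binomial series of
  \<open>(1 - x)^(-s)\<close>. The identity is Pfaff--Saalschuetz at \<open>u = c - a\<close>,
  \<open>v = c - b\<close>, divided by \<open>pochhammer c K * fact K\<close>.\<close>

lemma fps_hypergeo_euler_nth:
  fixes a b c :: "'a::field_char_0"
  assumes "pochhammer c K \<noteq> 0"
  shows "fps_nth (fps_hypergeo [a, b] [c] 1) K =
    fps_nth (fps_hypergeo [c - a, c - b] [c] 1 * fps_hypergeo [a + b - c] [] 1) K"
proof -
  have "pochhammer a K * pochhammer b K / (pochhammer c K * fact K) =
    (\<Sum>k\<le>K. of_nat (K choose k) * pochhammer (c - a) k * pochhammer (c - b) k *
       pochhammer (a + b - c) (K - k) * pochhammer (c + of_nat k) (K - k)) / (pochhammer c K * fact K)"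
    using pochhammer_saalschuetz[of c "c - a" K "c - b"] by (simp add: algebra_simps)
  also have "\<dots> = (\<Sum>k\<le>K. pochhammer (c - a) k * pochhammer (c - b) k / (pochhammer c k * fact k) *
       (pochhammer (a + b - c) (K - k) / fact (K - k)))"
    unfolding sum_divide_distrib
  proof (rule sum.cong)
    fix k assume "k \<in> {..K}"
    then have k: "k \<le> K" by simp
    have p: "pochhammer c K = pochhammer c k * pochhammer (c + of_nat k) (K - k)"
      using k by (rule pochhammer_product)
    with assms have "pochhammer c k \<noteq> 0" "pochhammer (c + of_nat k) (K - k) \<noteq> 0" by auto
    then show "of_nat (K choose k) * pochhammer (c - a) k * pochhammer (c - b) k *
       pochhammer (a + b - c) (K - k) * pochhammer (c + of_nat k) (K - k) / (pochhammer c K * fact K) =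
       pochhammer (c - a) k * pochhammer (c - b) k / (pochhammer c k * fact k) *
       (pochhammer (a + b - c) (K - k) / fact (K - k))"
      using k by (simp add: p binomial_fact field_simps)
  qed simp
  finally show ?thesis
    by (simp add: fps_mult_nth atLeast0AtMost)
qed

text \<open>The exponent law for powers of \<open>1 - x\<close>; on coefficients it is the
  Chu--Vandermonde identity.\<close>

lemma fps_hypergeo_binomial_mult:
  fixes a b :: "'a::field_char_0"
  shows "fps_hypergeo [a] [] 1 * fps_hypergeo [b] [] 1 = fps_hypergeo [a + b] [] 1"
proof (rule fps_ext)
  fix K
  have "pochhammer (a + b) K / fact K =
      (\<Sum>k\<le>K. pochhammer a k / fact k * (pochhammer b (K - k) / fact (K - k)))"
    unfolding pochhammer_binomial_sum sum_divide_distrib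
    by (intro sum.cong refl) (simp add: binomial_fact field_simps)
  then show "fps_nth (fps_hypergeo [a] [] 1 * fps_hypergeo [b] [] 1) K =
      fps_nth (fps_hypergeo [a + b] [] 1) K"
    by (simp add: fps_mult_nth atLeast0AtMost)
qed

text \<open>Coefficient \<open>M\<close> of a product involves only coefficients up to
  \<open>M\<close> of the factors, so Euler's transformation up to order \<open>M\<close>
  suffices.\<close>

lemma fps_hypergeo_euler_mult_nth:
  fixes a b c d :: "'a::field_char_0"
  assumes "pochhammer c M \<noteq> 0"
  shows "fps_nth (fps_hypergeo [a, b] [c] 1 * fps_hypergeo [d] [] 1) M =
    fps_nth (fps_hypergeo [c - a, c - b] [c] 1 * fps_hypergeo [a + b - c + d] [] 1) M"
proof -
  let ?F = "fps_hypergeo [a, b] [c] 1" and ?G = "fps_hypergeo [c - a, c - b] [c] 1"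
  let ?H = "\<lambda>d. fps_hypergeo [d] [] (1 :: 'a)"
  have "fps_nth (?F * ?H d) M = fps_nth ((?G * ?H (a + b - c)) * ?H d) M"
    unfolding fps_mult_nth[of ?F] fps_mult_nth[of "?G * ?H (a + b - c)"]
    using pochhammer_neq_0_mono[OF assms]
    by (intro sum.cong refl arg_cong2[of _ _ _ _ "(*)"] fps_hypergeo_euler_nth) simp
  then show ?thesis
    by (simp only: mult.assoc fps_hypergeo_binomial_mult)
qed

section \<open>The contour integral as a coefficient\<close>

lemma has_fps_expansion_one_minus_powr:
  fixes s :: complex
  shows "(\<lambda>x. (1 - x) powr s) has_fps_expansion fps_hypergeo [- s] [] 1"
proof (rule has_fps_expansionI)
  have "(\<lambda>k. fps_nth (fps_hypergeo [- s] [] 1) k * x ^ k) sums (1 - x) powr s"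
    if "x \<in> ball 0 1" for x
  proof -
    have "(\<lambda>k. (s gchoose k) * (- x) ^ k) sums (1 + - x) powr s"
      using that by (intro gen_binomial_complex) simp
    moreover have "(s gchoose k) * (- x) ^ k = fps_nth (fps_hypergeo [- s] [] 1) k * x ^ k" for k
      by (simp add: gbinomial_pochhammer power_minus[of x])
    ultimately show ?thesis by simp
  qed
  then show "\<forall>\<^sub>F x in nhds 0. (\<lambda>k. fps_nth (fps_hypergeo [- s] [] 1) k * x ^ k) sums (1 - x) powr s"
    by (auto intro!: eventually_nhds_in_open[THEN eventually_mono, of "ball 0 1"])
qed

lemma has_fps_expansion_hahn_2F1:
  assumes "m \<le> N"
  shows "hahn_2F1 N m b has_fps_expansion
    fps_hypergeo [of_nat m - of_nat N, b] [- of_nat N] 1"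
proof (rule has_fps_expansionI, rule always_eventually, rule allI)
  fix x :: complex
  let ?F = "fps_hypergeo [of_nat m - of_nat N, b] [- of_nat N] 1"
  \<comment> \<open>Beyond \<open>N - m\<close> the numerator vanishes. For \<open>k > N\<close> the
    denominator vanishes as well, and division by zero also yields 0.\<close>
  have "fps_nth ?F k = 0" if "k \<notin> {0..N - m}" for k
  proof -
    have "of_nat m - of_nat N = - (of_nat (N - m) :: complex)"
      using assms by (simp add: of_nat_diff)
    moreover have "k > N - m" using that by simp
    ultimately have "pochhammer (of_nat m - of_nat N :: complex) k = 0"
      by (simp only: pochhammer_of_nat_eq_0_lemma)
    then show ?thesis by simp
  qed
  then have "(\<lambda>k. fps_nth ?F k * x ^ k) sums (\<Sum>k\<in>{0..N - m}. fps_nth ?F k * x ^ k)"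
    by (intro sums_finite) auto
  then show "(\<lambda>k. fps_nth ?F k * x ^ k) sums hahn_2F1 N m b x"
    by (simp add: hahn_2F1_def)
qed

lemma U_tilde_eq_fps_nth:
  assumes "0 < a" "a < 1" "m \<le> N" "n \<le> N"
  shows "U_tilde a N \<alpha> \<beta> \<gamma> \<delta> m n = \<gamma> n * \<delta> m *
    fps_nth (fps_hypergeo [of_nat m - of_nat N, of_real (- real m - \<beta>)] [- of_nat N] 1 *
      fps_hypergeo [- of_real (1 - \<alpha>)] [] 1) (N - n)"
proof -
  define h where "h x = hahn_2F1 N m (of_real (- real m - \<beta>)) x * (1 - x) powr of_real (1 - \<alpha>)"
    for x :: complex
  let ?c = "\<gamma> n * \<delta> m"
  have exp: "h has_fps_expansion
      fps_hypergeo [of_nat m - of_nat N, of_real (- real m - \<beta>)] [- of_nat N] 1 *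
      fps_hypergeo [- of_real (1 - \<alpha>)] [] 1"
    unfolding h_def
    by (intro has_fps_expansion_mult has_fps_expansion_hahn_2F1 has_fps_expansion_one_minus_powr assms)
  have hol: "h holomorphic_on ball 0 1"
  proof -
    have "1 - x \<notin> \<real>\<^sub>\<le>\<^sub>0" if "x \<in> ball 0 1" for x :: complex
      using that complex_Re_le_cmod[of x] by (auto simp: complex_nonpos_Reals_iff)
    then show ?thesis
      unfolding h_def hahn_2F1_def by (intro holomorphic_intros) auto
  qed
  have power: "?c * x powi (- 1 + int n - int N) * (1 - x) powr of_real (1 - \<alpha>) *
      hahn_2F1 N m (of_real (- real m - \<beta>)) x = ?c * h x / (x - 0) ^ Suc (N - n)" for x
  proof -
    have "- 1 + int n - int N = - int (Suc (N - n))"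
      using assms by simp
    then have "x powi (- 1 + int n - int N) = inverse (x ^ Suc (N - n))"
      by (simp only: power_int_minus power_int_of_nat)
    then show ?thesis
      by (simp add: h_def divide_inverse mult_ac)
  qed
  have "contour_integral (circlepath 0 a) (\<lambda>x. ?c * h x / (x - 0) ^ Suc (N - n)) =
      ?c * ((2 * pi * \<i>) / fact (N - n) * (deriv ^^ (N - n)) h 0)"
  proof (rule contour_integral_unique)
    have "cball 0 a \<subseteq> ball 0 1" "ball 0 a \<subseteq> ball (0::complex) 1"
      using assms by auto
    then have "((\<lambda>x. h x / (x - 0) ^ Suc (N - n)) has_contour_integral
        ((2 * pi * \<i>) / fact (N - n) * (deriv ^^ (N - n)) h 0)) (circlepath 0 a)"
      using assms hol
      by (intro Cauchy_has_contour_integral_higher_derivative_circlepath)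
         (auto intro: holomorphic_on_subset holomorphic_on_imp_continuous_on)
    from has_contour_integral_lmul[OF this, of ?c]
    show "((\<lambda>x. ?c * h x / (x - 0) ^ Suc (N - n)) has_contour_integral
        ?c * ((2 * pi * \<i>) / fact (N - n) * (deriv ^^ (N - n)) h 0)) (circlepath 0 a)"
      by (simp only: times_divide_eq_right)
  qed
  \<comment> \<open>Here \<open>w\<close> stands for \<open>2 * pi * \<i>\<close> and
    \<open>d\<close> for the derivative of \<open>h\<close> at 0.\<close>
  moreover have "1 / w * (?c * (w / fact (N - n) * d)) = ?c * (d / fact (N - n))"
    if "w \<noteq> 0" for w d
    using that by (simp add: field_simps)
  moreover have "2 * of_real pi * \<i> \<noteq> 0"
    by simp
  ultimately show ?thesis
    unfolding U_tilde_def power fps_nth_fps_expansion[OF exp]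
    by (simp only: of_real_mult of_real_numeral)
qed

section \<open>The coefficient as a terminating series at 1\<close>

text \<open>The last \<open>k\<close> factors of \<open>pochhammer z M\<close>, negated and read
  backwards, start at \<open>1 - z - M\<close>.\<close>

lemma pochhammer_reflect_split:
  fixes z :: "'a::comm_ring_1"
  assumes "k \<le> M"
  shows "pochhammer z M = (- 1) ^ k * pochhammer (1 - z - of_nat M) k * pochhammer z (M - k)"
proof -
  have "pochhammer z M = pochhammer z (M - k) * pochhammer (z + of_nat (M - k)) k"
    using pochhammer_product[of "M - k" M z] assms by simp
  also have "pochhammer (z + of_nat (M - k)) k = (- 1) ^ k * pochhammer (1 - z - of_nat M) k"
    using pochhammer_minus'[of "z + of_nat M - 1" k] assms by (simp add: of_nat_diff algebra_simps)
  finally show ?thesis by (simp add: mult_ac)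
qed

text \<open>Reflecting \<open>pochhammer z (N - n)\<close> in the Cauchy product creates the lower
  parameter \<open>1 - z - (N - n)\<close>; reflecting the factorial creates the upper parameter
  \<open>n - N\<close>.\<close>

lemma hahn_3F2_eq_fps_nth:
  fixes b z :: complex
  assumes "n \<le> N" and nz: "pochhammer (1 - z - of_nat (N - n)) (N - n) \<noteq> 0"
  shows "pochhammer z (N - n) / fact (N - n) * hahn_3F2 N n m b (1 - z - of_nat (N - n)) =
    fps_nth (fps_hypergeo [- of_nat m, b] [- of_nat N] 1 * fps_hypergeo [z] [] 1) (N - n)"
proof -
  define M where "M = N - n"
  define g where "g k = pochhammer (- of_nat m) k * pochhammer b k / (pochhammer (- of_nat N) k * fact k)"
    for k
  have nM: "of_nat n - of_nat N = - (of_nat M :: complex)"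
    using assms(1) by (simp add: M_def of_nat_diff)
  have "pochhammer z M / fact M * hahn_3F2 N n m b (1 - z - of_nat M) =
      (\<Sum>k=0..min m M. g k * (pochhammer z (M - k) / fact (M - k)))"
    unfolding hahn_3F2_def sum_distrib_left M_def[symmetric] nM
  proof (rule sum.cong)
    fix k assume "k \<in> {0..min m M}"
    then have k: "k \<le> M" by simp
    have c: "pochhammer (1 - z - of_nat M) k \<noteq> 0"
      using pochhammer_neq_0_mono[OF nz] k by (simp add: M_def)
    \<comment> \<open>Reflection at \<open>z = 1\<close>, as \<open>M!\<close> is
      \<open>pochhammer 1 M\<close>.\<close>
    have f: "fact M = (- 1) ^ k * pochhammer (- of_nat M) k * (fact (M - k) :: complex)"
      using pochhammer_reflect_split[OF k, of 1] by (simp add: pochhammer_fact)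
    then have "pochhammer (- of_nat M :: complex) k \<noteq> 0"
      using fact_nonzero[of M, where ?'a = complex] by (metis mult_zero_left mult_zero_right)
    then show "pochhammer z M / fact M * (pochhammer (- of_nat M) k * pochhammer (- of_nat m) k *
        pochhammer b k / (pochhammer (- of_nat N) k * pochhammer (1 - z - of_nat M) k * fact k)) =
        g k * (pochhammer z (M - k) / fact (M - k))"
      unfolding f pochhammer_reflect_split[OF k, of z] g_def using c by (simp add: field_simps)
  qed simp
  \<comment> \<open>The added terms have \<open>k > m\<close>, where
    \<open>pochhammer (- m) k\<close> vanishes.\<close>
  also have "\<dots> = (\<Sum>k=0..M. g k * (pochhammer z (M - k) / fact (M - k)))"
    by (rule sum.mono_neutral_left) (auto simp: g_def pochhammer_of_nat_eq_0_lemma)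
  finally show ?thesis
    by (simp add: fps_mult_nth  g_def M_def)
qed

theorem mainTheorem15:
  fixes N m n :: nat and \<alpha> \<beta> a :: real and \<gamma> \<delta> :: "nat \<Rightarrow> complex"
  assumes "0 < a" and "a < 1"
    and "\<beta> + 2 - \<alpha> \<notin> real ` {1..N}"
    and "m \<in> {0..N}" and "n \<in> {0..N}"
  shows "U_tilde a N \<alpha> \<beta> \<gamma> \<delta> m n =
    \<delta> m * \<gamma> n * (pochhammer (of_real (\<alpha> - \<beta> - 1)) (N - n) / fact (N - n)) *
    hahn_3F2 N n m (of_real (real m - real N + \<beta>))
      (of_real (\<beta> + 2 - \<alpha> - real N + real n))"
proof -
  define z where "z = complex_of_real (\<alpha> - \<beta> - 1)"
  have m: "m \<le> N" and n: "n \<le> N" using assms by auto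
  have c: "complex_of_real (\<beta> + 2 - \<alpha> - real N + real n) = 1 - z - of_nat (N - n)"
    using n by (simp add: z_def of_nat_diff)
  \<comment> \<open>A zero factor at \<open>k < N - n\<close> would force \<beta> + 2 - \<alpha> = N
    - n - k, an excluded value.\<close>
  have nz: "pochhammer (1 - z - of_nat (N - n)) (N - n) \<noteq> 0"
  proof
    assume "pochhammer (1 - z - of_nat (N - n)) (N - n) = 0"
    then obtain k where k: "k < N - n" "complex_of_real (\<beta> + 2 - \<alpha> - real N + real n) = - of_nat k"
      unfolding pochhammer_eq_0_iff c by auto
    then have "complex_of_real (\<beta> + 2 - \<alpha> - real N + real n) = complex_of_real (- real k)"
      by simp
    then have "\<beta> + 2 - \<alpha> - real N + real n = - real k"
      by (simp only: of_real_eq_iff)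
    then have "\<beta> + 2 - \<alpha> = real (N - n - k)"
      using k n by (simp add: of_nat_diff)
    moreover have "N - n - k \<in> {1..N}" using k by auto
    ultimately show False using assms(3) by blast
  qed
  \<comment> \<open>The values of \<open>c - a\<close>, \<open>c - b\<close> and
    \<open>a + b - c + d\<close> in Euler's transformation for the given parameters.\<close>
  have par: "- of_nat N - (of_nat m - of_nat N) = - (of_nat m :: complex)"
    "- of_nat N - complex_of_real (- real m - \<beta>) = of_real (real m - real N + \<beta>)"
    "of_nat m - of_nat N + complex_of_real (- real m - \<beta>) - - of_nat N + - of_real (1 - \<alpha>) = z"
    by (simp_all add: z_def)
  have "pochhammer (- of_nat N :: complex) (N - n) \<noteq> 0"
    by (rule pochhammer_of_nat_eq_0_lemma') simp
  from fps_hypergeo_euler_mult_nth[OF this, of "of_nat m - of_nat N" "of_real (- real m - \<beta>)"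
      "- of_real (1 - \<alpha>)"]
  show ?thesis
    unfolding U_tilde_eq_fps_nth[OF assms(1,2) m n] par c hahn_3F2_eq_fps_nth[OF n nz, symmetric]
      z_def[symmetric]
    by (simp add: mult_ac)
qed

end
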